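(* For every instance of the strategic facility location game in an arbitrary metric space with $n$ clients, $k$ of them strategic, where $k<\frac n2$, the price of anarchy of Mechanism $GM^*$ is at most $\frac{n+2k}{n-2k}$.
   Context: Setting. An instance consists of a metric space with distance $d$; a set $\mathcal{C}$ of $n$ clients, each having a true location in the metric space (several clients may share a location; the true location of client $i$ is also denoted $i$); a finite nonempty set $\mathcal{F}$ of possible facility locations in the metric space, equipped with a fixed total ordering (an element earlier in the ordering is called lower-numbered); and a partition $\mathcal{C}=T\cup L$, $T\cap L=\emptyset$, with $|L|=k\ge 1$, $|T|=n-k$. Clients in $T$ always report their true location; each client $i\in L$ (strategic) may report any point $x_i$ of the metric space. Let $\vec t$ be the vector of true locations of clients in $T$ and $\vec x=(x_i)_{i\in L}$ the vector of reports of the strategic clients. Perceived cost of $A\in\mathcal{F}$: $cost_A(\vec t;\vec x)=\sum_{i\in T}d(i,A)+\sum_{i\in L}d(x_i,A)$. Mechanism $GM^*$: given reports $(\vec t;\vec x)$, output the facility $GM^*(\vec t;\vec x)\in\mathcal{F}$ minimizing $cost_A(\vec t;\vec x)$ over $A\in\mathcal{F}$, ties broken in favor of the lowest-numbered facility. Nash equilibrium (NE) under a mechanism $M$: a profile $(\vec t;\vec x)$ such that for every $i\in L$ and every point $x_i'$ of the metric space, $d(i,M(\vec t;\vec x_{-i},x_i'))\ge d(i,M(\vec t;\vec x))$, where $(\vec x_{-i},x_i')$ is $\vec x$ with $i$'s report replaced by $x_i'$. Price of anarchy: let $O\in\mathcal{F}$ minimize the true cost $\sum_{i\in\mathcal{C}}d(i,O)$,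 and let $S$ be the set of facilities $A$ such that some NE under the mechanism selects $A$. The price of anarchy of the instance is $\sup_{A\in S}\frac{\sum_{i\in\mathcal{C}}d(i,A)}{\sum_{i\in\mathcal{C}}d(i,O)}$. Saying that it is at most $c$ means that every $A\in S$ satisfies $\sum_{i\in\mathcal{C}}d(i,A)\le c\sum_{i\in\mathcal{C}}d(i,O)$ (this is also the meaning when the optimal cost is $0$). *)

theory Defs
  imports "HOL-Analysis.Analysis"
begin

text \<open>
  Clients are elements of a finite index set \<open>C\<close>, and \<open>loc i\<close> is the true location of client \<open>i\<close>,
  so several clients may share a location. The truthful clients form \<open>T\<close>, the strategic ones \<open>L\<close>.
  A pair \<open>(A, B) \<in> r\<close> means that facility \<open>A\<close> equals \<open>B\<close> or is lower-numbered than \<open>B\<close>.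
\<close>

locale facility_game = Metric_space M d
  for M :: "'a set" and d :: "'a \<Rightarrow> 'a \<Rightarrow> real" +
  fixes C T L :: "'c set"
    and loc :: "'c \<Rightarrow> 'a"
    and F :: "'a set"
    and r :: "('a \<times> 'a) set"
  assumes finite_clients: "finite C"
    and clients_partition: "C = T \<union> L" "T \<inter> L = {}"
    and strategic_nonempty: "L \<noteq> {}"
    and loc_in_space: "loc \<in> C \<rightarrow> M"
    and facilities_in_space: "F \<subseteq> M"
    and finite_facilities: "finite F"
    and facilities_nonempty: "F \<noteq> {}"
    and facilities_ordered: "linear_order_on F r"
begin

text \<open>
  A report vector is a pair of functions \<open>t\<close>, \<open>x\<close> on clients, of which only the values of \<open>t\<close>
  on \<open>T\<close> and of \<open>x\<close> on \<open>L\<close> matter.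
\<close>

definition perceived_cost :: "('c \<Rightarrow> 'a) \<Rightarrow> ('c \<Rightarrow> 'a) \<Rightarrow> 'a \<Rightarrow> real" where
  "perceived_cost t x A = (\<Sum>i\<in>T. d (t i) A) + (\<Sum>i\<in>L. d (x i) A)"

definition cost_minimizers :: "('c \<Rightarrow> 'a) \<Rightarrow> ('c \<Rightarrow> 'a) \<Rightarrow> 'a set" where
  "cost_minimizers t x =
    {A \<in> F. \<forall>B\<in>F. perceived_cost t x A \<le> perceived_cost t x B}"

definition GM_star :: "('c \<Rightarrow> 'a) \<Rightarrow> ('c \<Rightarrow> 'a) \<Rightarrow> 'a" where
  "GM_star t x =
    (THE A. A \<in> cost_minimizers t x \<and> (\<forall>B\<in>cost_minimizers t x. (A, B) \<in> r))"

definition nash_equilibrium ::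
  "(('c \<Rightarrow> 'a) \<Rightarrow> ('c \<Rightarrow> 'a) \<Rightarrow> 'a) \<Rightarrow> ('c \<Rightarrow> 'a) \<Rightarrow> bool" where
  "nash_equilibrium mech x \<longleftrightarrow>
    x \<in> L \<rightarrow> M \<and>
    (\<forall>i\<in>L. \<forall>y\<in>M. d (loc i) (mech loc (x(i := y))) \<ge> d (loc i) (mech loc x))"

definition equilibrium_facilities :: "(('c \<Rightarrow> 'a) \<Rightarrow> ('c \<Rightarrow> 'a) \<Rightarrow> 'a) \<Rightarrow> 'a set" where
  "equilibrium_facilities mech = {A \<in> F. \<exists>x. nash_equilibrium mech x \<and> mech loc x = A}"

definition social_cost :: "'a \<Rightarrow> real" where
  "social_cost A = (\<Sum>i\<in>C. d (loc i) A)"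

definition optimal_cost :: real where
  "optimal_cost = Min (social_cost ` F)"

text \<open>
  Division in \<^typ>\<open>ereal\<close> satisfies \<open>0 / 0 = 0\<close> and \<open>a / 0 = \<infinity>\<close> for \<open>a > 0\<close>; this is the right
  convention when the optimal cost is \<open>0\<close>, see \<open>price_of_anarchy_le_iff\<close> below.
\<close>

definition price_of_anarchy :: "(('c \<Rightarrow> 'a) \<Rightarrow> ('c \<Rightarrow> 'a) \<Rightarrow> 'a) \<Rightarrow> ereal" where
  "price_of_anarchy mech =
    (SUP A\<in>equilibrium_facilities mech. ereal (social_cost A) / ereal optimal_cost)"

lemma social_cost_nonneg: "social_cost A \<ge> 0"
  unfolding social_cost_def by (simp add: sum_nonneg)

lemma optimal_cost_nonneg: "optimal_cost \<ge> 0"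
  unfolding optimal_cost_def
  using finite_facilities facilities_nonempty social_cost_nonneg by auto

lemma price_of_anarchy_le_iff:
  assumes "c \<ge> 0"
  shows "price_of_anarchy mech \<le> ereal c \<longleftrightarrow>
    (\<forall>A\<in>equilibrium_facilities mech. social_cost A \<le> c * optimal_cost)"
proof -
  have "ereal (social_cost A) / ereal optimal_cost \<le> ereal c \<longleftrightarrow>
      social_cost A \<le> c * optimal_cost" for A
  proof (cases "optimal_cost = 0")
    case True
    then show ?thesis
      using social_cost_nonneg[of A] assms
      by (cases "social_cost A = 0") (auto simp: divide_ereal_def zero_ereal_def[symmetric])
  next
    case False
    then have "optimal_cost > 0" using optimal_cost_nonneg by simp
    then show ?thesis by (simp add: pos_divide_le_eq)
  qed
  then show ?thesis unfolding price_of_anarchy_def SUP_le_iff by blast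
qed

lemma ex1_lowest_cost_minimizer:
  "\<exists>!A. A \<in> cost_minimizers t x \<and> (\<forall>B\<in>cost_minimizers t x. (A, B) \<in> r)"
proof -
  have ord: "refl_on F r" "trans r" "antisym r" "total_on F r"
    using facilities_ordered by (simp_all add: order_on_defs)
  have least: "\<exists>A\<in>S. \<forall>B\<in>S. (A, B) \<in> r" if "finite S" "S \<noteq> {}" "S \<subseteq> F" for S
    using that
  proof (induction S rule: finite_ne_induct)
    case (singleton a)
    then show ?case using refl_onD[OF ord(1)] by simp
  next
    case (insert a S)
    then obtain m where m: "m \<in> S" "\<forall>B\<in>S. (m, B) \<in> r" by auto
    have aa: "(a, a) \<in> r" using insert.prems refl_onD[OF ord(1)] by simp
    have "a \<in> F" "m \<in> F" "a \<noteq> m" using insert.prems insert.hyps m(1) by auto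
    then have "(a, m) \<in> r \<or> (m, a) \<in> r" using ord(4) by (simp add: total_on_def)
    then show ?case
    proof
      assume am: "(a, m) \<in> r"
      have "(a, B) \<in> r" if "B \<in> insert a S" for B
        using that m(2) aa transD[OF ord(2) am] by auto
      then show ?thesis by blast
    next
      assume "(m, a) \<in> r"
      then show ?thesis using m by blast
    qed
  qed
  have "cost_minimizers t x \<noteq> {}"
  proof -
    have "\<exists>A\<in>F. perceived_cost t x A = Min (perceived_cost t x ` F)"
      using Min_in[of "perceived_cost t x ` F"] finite_facilities facilities_nonempty
      by (metis (no_types, lifting) finite_imageI image_iff image_is_empty)
    then obtain A where "A \<in> F" "\<forall>B\<in>F. perceived_cost t x A \<le> perceived_cost t x B"
      using finite_facilities by auto
    then show ?thesis by (auto simp: cost_minimizers_def)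
  qed
  moreover have "finite (cost_minimizers t x)" "cost_minimizers t x \<subseteq> F"
    using finite_facilities by (auto simp: cost_minimizers_def)
  ultimately obtain A where A:
    "A \<in> cost_minimizers t x" "\<forall>B\<in>cost_minimizers t x. (A, B) \<in> r"
    using least by blast
  show ?thesis
  proof (rule ex1I[of _ A])
    show "A \<in> cost_minimizers t x \<and> (\<forall>B\<in>cost_minimizers t x. (A, B) \<in> r)" using A by simp
  next
    fix A'
    assume "A' \<in> cost_minimizers t x \<and> (\<forall>B\<in>cost_minimizers t x. (A', B) \<in> r)"
    then show "A' = A" using A antisymD[OF ord(3)] by simp
  qed
qed

end

end

theory Submission
  imports Defs
begin

text \<open>
  Let \<open>A\<close> minimise the perceived cost and let \<open>B\<close> be any facility. Misreports can bias the comparison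
  of \<open>A\<close> with \<open>B\<close> by at most \<open>k * d A B\<close>, so the truthful cost of \<open>A\<close> exceeds that of \<open>B\<close> by at
  most this amount. The \<open>n - k\<close> truthful clients in turn bound \<open>d A B\<close> by the triangle inequality,
  giving \<open>(n - 2 * k) * d A B \<le> 2 * (\<Sum>i\<in>T. d (loc i) B)\<close>. Since the strategic clients also lose
  at most \<open>k * d A B\<close> when \<open>A\<close> is chosen instead of \<open>B\<close>, the social cost grows at most by the factor
  \<open>1 + 4 * k / (n - 2 * k)\<close>.
\<close>

lemma (in facility_game) social_cost_cost_minimizer_le:
  assumes x: "x \<in> L \<rightarrow> M"
    and A: "A \<in> cost_minimizers loc x"
    and B: "B \<in> F"
    and less: "2 * card L < card C"
  shows "social_cost A \<le>
    (real (card C) + 2 * real (card L)) / (real (card C) - 2 * real (card L)) * social_cost B"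
proof -
  define n k where "n = real (card C)" and "k = real (card L)"
  have fin: "finite T" "finite L" using finite_clients clients_partition by auto
  have card_T: "real (card T) = n - k"
    using fin clients_partition by (simp add: n_def k_def card_Un_disjoint)
  have pos: "n - 2 * k > 0" using less by (simp add: n_def k_def)
  have split: "social_cost P = (\<Sum>i\<in>T. d (loc i) P) + (\<Sum>i\<in>L. d (loc i) P)" for P
    using sum.union_disjoint[OF fin clients_partition(2)]
    unfolding social_cost_def by (simp add: clients_partition(1))
  have AF: "A \<in> F" and le: "perceived_cost loc x A \<le> perceived_cost loc x B"
    using A B by (auto simp: cost_minimizers_def)
  have AB: "A \<in> M" "B \<in> M" using AF B facilities_in_space by auto
  have locM: "loc i \<in> M" if "i \<in> T \<union> L" for i
    using that loc_in_space clients_partition(1) by auto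
  have "(\<Sum>i\<in>L. d (x i) B) \<le> (\<Sum>i\<in>L. d (x i) A + d A B)"
    by (intro sum_mono triangle) (use x AB in auto)
  then have truthful: "(\<Sum>i\<in>T. d (loc i) A) \<le> (\<Sum>i\<in>T. d (loc i) B) + k * d A B"
    using le by (simp add: perceived_cost_def sum.distrib k_def)
  have "(\<Sum>i\<in>T. d A B) \<le> (\<Sum>i\<in>T. d (loc i) A + d (loc i) B)"
    by (intro sum_mono triangle'') (use locM AB in auto)
  then have "(n - k) * d A B \<le> (\<Sum>i\<in>T. d (loc i) A) + (\<Sum>i\<in>T. d (loc i) B)"
    by (simp add: sum.distrib card_T)
  \<comment> \<open>Replacing the sum for \<open>A\<close> via \<open>truthful\<close> adds
    \<open>k * d A B\<close> on the right; absorbing it on the left turns \<open>n - k\<close> into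
    \<open>n - 2 * k\<close>.\<close>
  with truthful have "(n - 2 * k) * d A B \<le> 2 * (\<Sum>i\<in>T. d (loc i) B)"
    by (simp add: algebra_simps)
  also have "\<dots> \<le> 2 * social_cost B"
    by (simp add: split sum_nonneg)
  finally have dist: "d A B \<le> 2 * social_cost B / (n - 2 * k)"
    using pos by (simp add: field_simps)
  have "(\<Sum>i\<in>L. d (loc i) A) \<le> (\<Sum>i\<in>L. d (loc i) B + d A B)"
    by (intro sum_mono triangle') (use locM AB in auto)
  \<comment> \<open>One \<open>k * d A B\<close> comes from \<open>truthful\<close>, the other from
    the strategic clients' own loss.\<close>
  then have "social_cost A \<le> social_cost B + 2 * k * d A B"
    using truthful by (simp add: split sum.distrib k_def)
  also have "\<dots> \<le> social_cost B + 2 * k * (2 * social_cost B / (n - 2 * k))"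
    by (intro add_left_mono mult_left_mono dist) (simp add: k_def)
  also have "\<dots> = (n + 2 * k) / (n - 2 * k) * social_cost B"
    using pos by (simp add: field_simps)
  finally show ?thesis by (simp add: n_def k_def)
qed

theorem theorem3p5:
  fixes M :: "'a set" and d :: "'a \<Rightarrow> 'a \<Rightarrow> real"
    and C T L :: "'c set"
    and loc :: "'c \<Rightarrow> 'a"
    and F :: "'a set" and r :: "('a \<times> 'a) set"
    and n k :: nat
  assumes "facility_game M d C T L loc F r"
    and "card C = n" and "card L = k"
    and "real k < real n / 2"
  shows "facility_game.price_of_anarchy M d C L loc F (facility_game.GM_star d T L F r)
    \<le> ereal ((real n + 2 * real k) / (real n - 2 * real k))"
proof -
  interpret facility_game M d C T L loc F r by fact
  have less: "2 * card L < card C" using assms by simp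
  \<comment> \<open>The product form also covers an optimal cost of 0, where the ratio
    degenerates.\<close>
  have "social_cost A \<le> (real n + 2 * real k) / (real n - 2 * real k) * optimal_cost"
    if eq: "A \<in> equilibrium_facilities GM_star" for A
  proof -
    obtain x where x: "x \<in> L \<rightarrow> M" and A: "GM_star loc x = A"
      using eq unfolding equilibrium_facilities_def nash_equilibrium_def by blast
    \<comment> \<open>A unique lowest-numbered minimizer exists, so the \<open>THE\<close> in
      \<open>GM_star\<close> denotes it and inherits cost minimality.\<close>
    have "A \<in> cost_minimizers loc x"
      using theI'[OF ex1_lowest_cost_minimizer[of loc x]] A by (simp add: GM_star_def)
    moreover have "optimal_cost \<in> social_cost ` F"
      unfolding optimal_cost_def using finite_facilities facilities_nonempty by simp
    then obtain B where "B \<in> F" "optimal_cost = social_cost B" by blast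
    ultimately show ?thesis
      using social_cost_cost_minimizer_le[OF x _ _ less] assms(2,3) by simp
  qed
  moreover have "(real n + 2 * real k) / (real n - 2 * real k) \<ge> 0"
    using assms(4) by simp
  ultimately show ?thesis by (simp add: price_of_anarchy_le_iff)
qed

end
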